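(* There exist decidable equivalence relations $F$ and $G$ on $\mathbb{N}$ such that $F \vee G$ is a semi-decidable FC equivalence relation that is not decidable, and $F \vee G = FGF$.
   Context: $\mathbb{N}=\{0,1,2,\dots\}$. Relations are subsets of $\mathbb{N}\times\mathbb{N}$. "Decidable" means recursive; "semi-decidable" means recursively enumerable. An equivalence relation on $\mathbb{N}$ is called FC if every one of its equivalence classes is finite. The composition of binary relations is $RS=\{(x,z) : \exists y\, [(x,y)\in R \text{ and } (y,z)\in S]\}$. $F\vee G$ denotes the join in the lattice of equivalence relations, i.e. the transitive closure of $F\cup G$. *)

theory Defs
  imports Main
begin

text \<open>
  Computability is based on the partial recursive (mu-recursive) functions. Programs carry no
  arity: for every \<open>n\<close>, a program denotes an \<open>n\<close>-ary partial function, namely its behaviour on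
  argument lists of length \<open>n\<close>.
\<close>

datatype recf =
    Zero
  | Succ
  | Proj nat
  | Comp recf "recf list"
  | PRec recf recf
  | Mu recf

text \<open>
  \<open>computes p xs v\<close>: the program \<open>p\<close> halts on the argument list \<open>xs\<close> with result \<open>v\<close>.
  In \<open>Comp f gs\<close> all of the \<open>gs\<close> must halt, even where \<open>f\<close> ignores an argument. \<open>Mu f\<close> diverges
  unless \<open>f\<close> is defined at all candidates below the least zero.
\<close>

inductive computes :: "recf \<Rightarrow> nat list \<Rightarrow> nat \<Rightarrow> bool" where
  Zero: "computes Zero xs 0"
| Succ: "computes Succ [x] (Suc x)"
| Proj: "i < length xs \<Longrightarrow> computes (Proj i) xs (xs ! i)"
| Comp: "\<lbrakk>list_all2 (\<lambda>g y. computes g xs y) gs ys; computes f ys v\<rbrakk>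
    \<Longrightarrow> computes (Comp f gs) xs v"
| PRec_0: "computes f xs v \<Longrightarrow> computes (PRec f g) (0 # xs) v"
| PRec_Suc: "\<lbrakk>computes (PRec f g) (n # xs) u; computes g (n # u # xs) v\<rbrakk>
    \<Longrightarrow> computes (PRec f g) (Suc n # xs) v"
| Mu: "\<lbrakk>computes f (z # xs) 0; \<forall>i<z. \<exists>u. computes f (i # xs) (Suc u)\<rbrakk>
    \<Longrightarrow> computes (Mu f) xs z"

lemma computes_deterministic:
  assumes "computes p xs v" and "computes p xs w"
  shows "v = w"
  using assms
proof (induction arbitrary: w rule: computes.induct)
  case (Comp xs gs ys f v)
  from Comp.prems obtain zs where zs: "list_all2 (\<lambda>g y. computes g xs y) gs zs" "computes f zs w"
    by cases
  have "ys = zs"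
    using Comp.IH(1) zs(1) by (auto simp: list_all2_conv_all_nth intro!: nth_equalityI)
  then show ?case
    using Comp.IH(2) zs(2) by simp
next
  case (PRec_Suc f g n xs u v)
  from PRec_Suc.prems show ?case
    by cases (use PRec_Suc.IH in blast)
next
  case (Mu f z xs)
  from Mu.prems obtain A: "computes f (w # xs) 0" and B: "\<forall>i<w. \<exists>u. computes f (i # xs) (Suc u)"
    by cases
  have "\<not> z < w"
    using B Mu.IH(1) by (metis nat.distinct(1))
  moreover have "\<not> w < z"
    using A Mu.IH(2) by (metis nat.distinct(1))
  ultimately show ?case
    by simp
qed (erule computes.cases; simp)+

definition decidable_rel :: "(nat \<times> nat) set \<Rightarrow> bool" where
  "decidable_rel R \<longleftrightarrow> (\<exists>p. \<forall>x y. computes p [x, y] (if (x, y) \<in> R then 1 else 0))"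

definition semidecidable_rel :: "(nat \<times> nat) set \<Rightarrow> bool" where
  "semidecidable_rel R \<longleftrightarrow> (\<exists>p. \<forall>x y. (x, y) \<in> R \<longleftrightarrow> (\<exists>v. computes p [x, y] v))"

definition FC_equiv :: "(nat \<times> nat) set \<Rightarrow> bool" where
  "FC_equiv R \<longleftrightarrow> equiv UNIV R \<and> (\<forall>C \<in> UNIV // R. finite C)"

definition equiv_join :: "(nat \<times> nat) set \<Rightarrow> (nat \<times> nat) set \<Rightarrow> (nat \<times> nat) set" where
  "equiv_join F G = (F \<union> G)\<^sup>+"

end

theory Submission
  imports Defs "HOL-Library.Nat_Bijection"
begin

text \<open>
  Fix a decidable relation \<open>T\<close> such that every \<open>n\<close> has at most one \<open>s\<close> with \<open>T n s\<close>, and such that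
  \<open>{n. \<exists>s. T n s}\<close> is undecidable. Take points \<open>(i, n, s)\<close>; let \<open>F\<close> identify \<open>(i, n, 0)\<close> with
  \<open>(i, n, s)\<close> when \<open>T n s\<close>, and let \<open>G\<close> identify \<open>(0, n, s)\<close> with \<open>(1, n, s)\<close> when \<open>s > 0\<close>.
  Then \<open>(0, n, 0)\<close> and \<open>(1, n, 0)\<close> are joined, namely by an \<open>FGF\<close> path through level \<open>s\<close>, iff
  \<open>T n s\<close> for some \<open>s\<close>. Here \<open>T n s\<close> says that an abstract machine that interprets programs,
  started on program \<open>n\<close> with input \<open>n\<close>, returns \<open>0\<close> after exactly \<open>s\<close> steps. The machine is
  deterministic, so for the diagonal argument it suffices that it reproduces every halting
  computation.
\<close>

section \<open>Total recursive functions\<close>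

text \<open>Programs carry no arity, so \<open>k\<close> is explicit; lists of other lengths are
  left unconstrained, which permits expressions such as \<open>xs ! i\<close>.\<close>

definition total_recursive :: "nat \<Rightarrow> (nat list \<Rightarrow> nat) \<Rightarrow> bool" where
  "total_recursive k f \<longleftrightarrow> (\<exists>p. \<forall>xs. length xs = k \<longrightarrow> computes p xs (f xs))"

lemma total_recursive_cong:
  assumes "total_recursive k f" and "\<And>xs. length xs = k \<Longrightarrow> f xs = g xs"
  shows "total_recursive k g"
  using assms unfolding total_recursive_def by metis

lemma total_recursive_nth: "i < k \<Longrightarrow> total_recursive k (\<lambda>xs. xs ! i)"
  unfolding total_recursive_def by (metis computes.Proj)

lemma total_recursive_compose:
  assumes h: "total_recursive (length fs) h" and fs: "\<forall>f \<in> set fs. total_recursive k f"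
  shows "total_recursive k (\<lambda>xs. h (map (\<lambda>f. f xs) fs))"
proof -
  obtain q where q: "\<And>ys. length ys = length fs \<Longrightarrow> computes q ys (h ys)"
    using h unfolding total_recursive_def by blast
  obtain p where p: "\<And>f xs. f \<in> set fs \<Longrightarrow> length xs = k \<Longrightarrow> computes (p f) xs (f xs)"
    using fs unfolding total_recursive_def by metis
  have "computes (Comp q (map p fs)) xs (h (map (\<lambda>f. f xs) fs))" if "length xs = k" for xs
    using that by (intro computes.Comp[OF _ q]) (auto simp: list_all2_conv_all_nth p)
  then show ?thesis
    unfolding total_recursive_def by blast
qed

lemma total_recursive_compose1:
  assumes "total_recursive 1 (\<lambda>ys. h (ys ! 0))" and "total_recursive k f"
  shows "total_recursive k (\<lambda>xs. h (f xs))"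
  using total_recursive_compose[of "[f]" "\<lambda>ys. h (ys ! 0)" k] assms by simp

lemma total_recursive_compose2:
  assumes "total_recursive 2 (\<lambda>ys. h (ys ! 0) (ys ! 1))"
    and "total_recursive k f" and "total_recursive k g"
  shows "total_recursive k (\<lambda>xs. h (f xs) (g xs))"
  using total_recursive_compose[of "[f, g]" "\<lambda>ys. h (ys ! 0) (ys ! 1)" k] assms
  by (simp add: numeral_2_eq_2)

lemma total_recursive_prec:
  assumes f: "total_recursive k f"
    and g: "total_recursive (Suc (Suc k)) g"
  shows "total_recursive (Suc k) (\<lambda>xs. rec_nat (f (tl xs)) (\<lambda>n u. g (n # u # tl xs)) (hd xs))"
proof -
  obtain p where p: "\<And>xs. length xs = k \<Longrightarrow> computes p xs (f xs)"
    using f unfolding total_recursive_def by blast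
  obtain q where q: "\<And>xs. length xs = Suc (Suc k) \<Longrightarrow> computes q xs (g xs)"
    using g unfolding total_recursive_def by blast
  have "computes (PRec p q) (n # ys) (rec_nat (f ys) (\<lambda>n u. g (n # u # ys)) n)"
    if "length ys = k" for n ys
  proof (induction n)
    case 0
    show ?case using computes.PRec_0[OF p[OF that]] by simp
  next
    case (Suc n)
    show ?case using computes.PRec_Suc[OF Suc q] that by simp
  qed
  then have "computes (PRec p q) xs (rec_nat (f (tl xs)) (\<lambda>n u. g (n # u # tl xs)) (hd xs))"
    if "length xs = Suc k" for xs
    using that by (cases xs) auto
  then show ?thesis
    unfolding total_recursive_def by blast
qed

lemma total_recursive_Suc:
  assumes "total_recursive k f"
  shows "total_recursive k (\<lambda>xs. Suc (f xs))"
proof (rule total_recursive_compose1[OF _ assms])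
  have "computes Succ xs (Suc (xs ! 0))" if "length xs = 1" for xs
    using that computes.Succ by (cases xs) auto
  then show "total_recursive 1 (\<lambda>ys. Suc (ys ! 0))"
    unfolding total_recursive_def by blast
qed

lemma total_recursive_const: "total_recursive k (\<lambda>xs. c)"
proof (induction c)
  case 0
  show ?case
    unfolding total_recursive_def using computes.Zero by blast
next
  case (Suc c)
  then show ?case by (rule total_recursive_Suc)
qed

text \<open>The count \<open>c\<close> and the single parameter \<open>a\<close> are arbitrary
  recursive functions, so the rule applies inside larger expressions; a recursion without a
  parameter sets \<open>a\<close> to a constant.\<close>

lemma total_recursive_rec_nat:
  assumes "total_recursive 1 (\<lambda>ys. f (ys ! 0))"
    and "total_recursive 3 (\<lambda>ys. g (ys ! 0) (ys ! 1) (ys ! 2))"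
    and "total_recursive k c" and "total_recursive k a"
  shows "total_recursive k (\<lambda>xs. rec_nat (f (a xs)) (\<lambda>n u. g n u (a xs)) (c xs))"
proof (rule total_recursive_compose2[OF _ assms(3,4)])
  have "total_recursive (Suc 1) (\<lambda>xs. rec_nat (f (tl xs ! 0))
      (\<lambda>n u. g ((n # u # tl xs) ! 0) ((n # u # tl xs) ! 1) ((n # u # tl xs) ! 2)) (hd xs))"
    using assms(2) by (intro total_recursive_prec[OF assms(1)]) (simp add: numeral_3_eq_3)
  then show "total_recursive 2 (\<lambda>ys. rec_nat (f (ys ! 1)) (\<lambda>n u. g n u (ys ! 1)) (ys ! 0))"
    unfolding Suc_1 by (rule total_recursive_cong) (auto simp: numeral_2_eq_2 length_Suc_conv)
qed

section \<open>Arithmetic and conditionals\<close>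

lemma total_recursive_add:
  assumes "total_recursive k f" and "total_recursive k g"
  shows "total_recursive k (\<lambda>xs. f xs + g xs)"
proof -
  have "total_recursive k (\<lambda>xs. rec_nat (g xs) (\<lambda>n u. Suc u) (f xs))"
    by (intro total_recursive_rec_nat[where f = "\<lambda>a. a"] total_recursive_nth
        total_recursive_Suc assms) simp_all
  moreover have "rec_nat b (\<lambda>n u. Suc u) a = a + b" for a b
    by (induction a) auto
  ultimately show ?thesis by simp
qed

lemma total_recursive_pred:
  assumes "total_recursive k f"
  shows "total_recursive k (\<lambda>xs. f xs - 1)"
proof -
  have "total_recursive k (\<lambda>xs. rec_nat 0 (\<lambda>n u. n) (f xs))"
    by (intro total_recursive_rec_nat[where f = "\<lambda>a. 0" and a = "\<lambda>xs. 0"] total_recursive_nth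
        total_recursive_const assms) simp_all
  moreover have "rec_nat 0 (\<lambda>n u. n) a = a - 1" for a :: nat
    by (cases a) auto
  ultimately show ?thesis by simp
qed

lemma total_recursive_diff:
  assumes "total_recursive k f" and "total_recursive k g"
  shows "total_recursive k (\<lambda>xs. f xs - g xs)"
proof -
  have "total_recursive k (\<lambda>xs. rec_nat (f xs) (\<lambda>n u. u - 1) (g xs))"
    by (intro total_recursive_rec_nat[where f = "\<lambda>a. a"] total_recursive_nth
        total_recursive_pred assms) simp_all
  moreover have "rec_nat a (\<lambda>n u. u - 1) b = a - b" for a b :: nat
    by (induction b) auto
  ultimately show ?thesis by simp
qed

lemma total_recursive_mult:
  assumes "total_recursive k f" and "total_recursive k g"
  shows "total_recursive k (\<lambda>xs. f xs * g xs)"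
proof -
  have "total_recursive k (\<lambda>xs. rec_nat 0 (\<lambda>n u. u + g xs) (f xs))"
    by (intro total_recursive_rec_nat[where f = "\<lambda>a. 0"] total_recursive_nth
        total_recursive_const total_recursive_add assms) simp_all
  moreover have "rec_nat 0 (\<lambda>n u. u + b) a = a * b" for a b :: nat
    by (induction a) auto
  ultimately show ?thesis by simp
qed

lemma total_recursive_if_eq:
  assumes "total_recursive k a" and "total_recursive k b"
    and "total_recursive k f" and "total_recursive k g"
  shows "total_recursive k (\<lambda>xs. if a xs = b xs then f xs else g xs)"
proof (rule total_recursive_cong)
  \<comment> \<open>With truncated subtraction \<open>?d\<close> vanishes iff the two values agree,
    so \<open>1 - ?d\<close> is the 0/1 indicator of equality.\<close>
  let ?d = "\<lambda>xs. (a xs - b xs) + (b xs - a xs)"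
  show "total_recursive k (\<lambda>xs. (1 - ?d xs) * f xs + (1 - (1 - ?d xs)) * g xs)"
    by (intro total_recursive_add total_recursive_diff total_recursive_mult
        total_recursive_const assms)
qed auto

section \<open>Pairs and lists\<close>

definition pair :: "nat \<Rightarrow> nat \<Rightarrow> nat" where
  "pair a b = prod_encode (a, b)"

definition left :: "nat \<Rightarrow> nat" where
  "left z = fst (prod_decode z)"

definition right :: "nat \<Rightarrow> nat" where
  "right z = snd (prod_decode z)"

lemma left_pair [simp]: "left (pair a b) = a"
  and right_pair [simp]: "right (pair a b) = b"
  by (simp_all add: left_def right_def pair_def)

lemma pair_left_right [simp]: "pair (left z) (right z) = z"
  by (simp add: left_def right_def pair_def)

lemma pair_eq_iff [simp]: "pair a b = pair c d \<longleftrightarrow> a = c \<and> b = d"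
  by (simp add: pair_def)

text \<open>The successor keeps 0 free for the empty list, in agreement with
  \<open>list_encode\<close>.\<close>

definition cons :: "nat \<Rightarrow> nat \<Rightarrow> nat" where
  "cons a l = Suc (pair a l)"

definition head :: "nat \<Rightarrow> nat" where
  "head l = left (l - 1)"

definition tail :: "nat \<Rightarrow> nat" where
  "tail l = right (l - 1)"

lemma head_cons [simp]: "head (cons a l) = a"
  and tail_cons [simp]: "tail (cons a l) = l"
  and cons_neq_0 [simp]: "cons a l \<noteq> 0"
  by (simp_all add: head_def tail_def cons_def)

lemma list_encode_Cons_eq_cons [simp]: "list_encode (x # xs) = cons x (list_encode xs)"
  by (simp add: cons_def pair_def)

declare list_encode.simps(2) [simp del]

text \<open>The index of the antidiagonal on which \<open>prod_encode\<close> places \<open>n\<close>.\<close>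

definition antidiagonal :: "nat \<Rightarrow> nat" where
  "antidiagonal n = rec_nat 0 (\<lambda>m k. if Suc m = triangle (Suc k) then Suc k else k) n"

text \<open>The recursion raises the index exactly when the argument reaches the next triangular
  number.\<close>

lemma antidiagonal_bounds:
  "triangle (antidiagonal n) \<le> n \<and> n < triangle (Suc (antidiagonal n))"
proof (induction n)
  case 0
  show ?case by (simp add: antidiagonal_def)
next
  case (Suc n)
  have "antidiagonal (Suc n) =
      (if Suc n = triangle (Suc (antidiagonal n)) then Suc (antidiagonal n) else antidiagonal n)"
    by (simp add: antidiagonal_def)
  with Suc show ?case by auto
qed

text \<open>A pair \<open>(a, b)\<close> is encoded as \<open>triangle (a + b) + a\<close>: the
  offset on the antidiagonal is \<open>a\<close> and the index is the sum. This form shows that the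
  projections are recursive.\<close>

lemma prod_decode_antidiagonal:
  "prod_decode n =
    (n - triangle (antidiagonal n), antidiagonal n - (n - triangle (antidiagonal n)))"
proof -
  have "n - triangle (antidiagonal n) \<le> antidiagonal n" "triangle (antidiagonal n) \<le> n"
    using antidiagonal_bounds[of n] by auto
  then have "prod_encode
      (n - triangle (antidiagonal n), antidiagonal n - (n - triangle (antidiagonal n))) = n"
    by (simp add: prod_encode_def)
  then show ?thesis
    by (metis prod_encode_inverse)
qed

lemma total_recursive_triangle:
  assumes "total_recursive k f"
  shows "total_recursive k (\<lambda>xs. triangle (f xs))"
proof -
  have "total_recursive k (\<lambda>xs. rec_nat 0 (\<lambda>n u. u + Suc n) (f xs))"
    by (intro total_recursive_rec_nat[where f = "\<lambda>a. 0" and a = "\<lambda>xs. 0"] total_recursive_nth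
        total_recursive_const total_recursive_add total_recursive_Suc assms) simp_all
  moreover have "rec_nat 0 (\<lambda>n u. u + Suc n) a = triangle a" for a :: nat
    by (induction a) auto
  ultimately show ?thesis by simp
qed

lemma total_recursive_antidiagonal:
  assumes "total_recursive k f"
  shows "total_recursive k (\<lambda>xs. antidiagonal (f xs))"
  unfolding antidiagonal_def
  by (intro total_recursive_rec_nat[where f = "\<lambda>a. 0" and a = "\<lambda>xs. 0"] total_recursive_nth
      total_recursive_const total_recursive_if_eq total_recursive_Suc total_recursive_triangle
      assms) simp_all

lemma total_recursive_pair:
  assumes "total_recursive k f" and "total_recursive k g"
  shows "total_recursive k (\<lambda>xs. pair (f xs) (g xs))"
  unfolding pair_def prod_encode_def prod.case
  by (intro total_recursive_add total_recursive_triangle assms)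

lemma total_recursive_left:
  assumes "total_recursive k f"
  shows "total_recursive k (\<lambda>xs. left (f xs))"
  unfolding left_def prod_decode_antidiagonal fst_conv
  by (intro total_recursive_diff total_recursive_triangle total_recursive_antidiagonal assms)

lemma total_recursive_right:
  assumes "total_recursive k f"
  shows "total_recursive k (\<lambda>xs. right (f xs))"
  unfolding right_def prod_decode_antidiagonal snd_conv
  by (intro total_recursive_diff total_recursive_triangle total_recursive_antidiagonal assms)

lemmas total_recursive_intros =
  total_recursive_const total_recursive_Suc total_recursive_pred total_recursive_if_eq
  total_recursive_pair total_recursive_left total_recursive_right

section \<open>An interpreter as an abstract machine\<close>

text \<open>The tag 6 is reserved for argument lists, which the machine evaluates like programs.\<close>

primrec code :: "recf \<Rightarrow> nat" where
  "code Zero = pair 0 0"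
| "code Succ = pair 1 0"
| "code (Proj i) = pair 2 i"
| "code (Comp f gs) = pair 3 (pair (code f) (list_encode (map code gs)))"
| "code (PRec f g) = pair 4 (pair (code f) (code g))"
| "code (Mu f) = pair 5 (code f)"

definition eval_state :: "nat \<Rightarrow> nat \<Rightarrow> nat \<Rightarrow> nat" where
  "eval_state p xs k = pair 0 (pair p (pair xs k))"

definition return_state :: "nat \<Rightarrow> nat \<Rightarrow> nat" where
  "return_state v k = pair 1 (pair v k)"

text \<open>
  Here \<open>k\<close> is the stack of pending frames. The frames are: apply \<open>f\<close> to the returned argument list
  (0), continue a primitive recursion (1), test the value of a minimization candidate (2), evaluate
  the remaining arguments (3), prepend an argument to the returned list (4).
\<close>

definition eval_step :: "nat \<Rightarrow> nat \<Rightarrow> nat \<Rightarrow> nat" where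
  "eval_step p xs k =
    (if left p = 0 then return_state 0 k
     else if left p = 1 then return_state (Suc (head xs)) k
     else if left p = 2 then
       (if right p = 0 then return_state (head xs) k
        else eval_state (pair 2 (right p - 1)) (tail xs) k)
     else if left p = 3 then
       eval_state (pair 6 (right (right p))) xs (cons (pair 0 (left (right p))) k)
     else if left p = 4 then
       (if head xs = 0 then eval_state (left (right p)) (tail xs) k
        else eval_state p (cons (head xs - 1) (tail xs))
          (cons (pair 1 (pair (right (right p)) (cons (head xs - 1) (tail xs)))) k))
     else if left p = 5 then
       eval_state (right p) (cons 0 xs) (cons (pair 2 (pair (right p) (cons 0 xs))) k)
     else
       (if right p = 0 then return_state 0 k
        else eval_state (head (right p)) xs (cons (pair 3 (pair (tail (right p)) xs)) k)))"

text \<open>The content \<open>b\<close> of a frame, by tag: \<open>f\<close> alone (0);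
  \<open>g\<close> with the list \<open>n # xs\<close> (1); \<open>f\<close> with the list
  \<open>i # xs\<close> for the candidate \<open>i\<close> (2); the remaining programs with their
  common arguments (3); a value already computed (4).\<close>

definition resume_step :: "nat \<Rightarrow> nat \<Rightarrow> nat \<Rightarrow> nat \<Rightarrow> nat" where
  "resume_step v t b k =
    (if t = 0 then eval_state b v k
     else if t = 1 then
       eval_state (left b) (cons (head (right b)) (cons v (tail (right b)))) k
     else if t = 2 then
       (if v = 0 then return_state (head (right b)) k
        else eval_state (left b) (cons (Suc (head (right b))) (tail (right b)))
          (cons (pair 2 (pair (left b) (cons (Suc (head (right b))) (tail (right b))))) k))
     else if t = 3 then eval_state (pair 6 (left b)) (right b) (cons (pair 4 v) k)
     else return_state (cons b v) k)"

text \<open>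
  After returning to the empty stack the machine moves to the stuck state \<open>pair 2 0\<close>, so that it
  is in a final state at one moment only.
\<close>

definition step :: "nat \<Rightarrow> nat" where
  "step z =
    (if left z = 0 then eval_step (left (right z)) (left (right (right z))) (right (right (right z)))
     else if left z = 1 then
       (if right (right z) = 0 then pair 2 0
        else resume_step (left (right z)) (left (head (right (right z))))
          (right (head (right (right z)))) (tail (right (right z))))
     else z)"

lemma step_eval_state: "step (eval_state p xs k) = eval_step p xs k"
  by (simp add: step_def eval_state_def)

lemma step_return_state:
  "step (return_state v (cons (pair t b) k)) = resume_step v t b k"
  by (simp add: step_def return_state_def)

text \<open>One step is a finite case distinction over pairings and projections; recursion and
  search of the interpreted program live on the stack.\<close>

lemma total_recursive_step:
  assumes "total_recursive k f"
  shows "total_recursive k (\<lambda>xs. step (f xs))"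
  unfolding step_def eval_step_def resume_step_def eval_state_def return_state_def
    head_def tail_def cons_def
  by (intro total_recursive_intros assms)

lemma total_recursive_funpow_step:
  assumes "total_recursive k f" and "total_recursive k g"
  shows "total_recursive k (\<lambda>xs. (step ^^ f xs) (g xs))"
proof -
  have "total_recursive k (\<lambda>xs. rec_nat (g xs) (\<lambda>n. step) (f xs))"
    by (intro total_recursive_rec_nat[where f = "\<lambda>a. a"] total_recursive_nth
        total_recursive_step assms) simp_all
  moreover have "rec_nat a (\<lambda>n. step) m = (step ^^ m) a" for a m
    by (induction m) auto
  ultimately show ?thesis by simp
qed

section \<open>Simulation of halting computations\<close>

definition reaches :: "nat \<Rightarrow> nat \<Rightarrow> bool" where
  "reaches a b \<longleftrightarrow> (\<exists>s. (step ^^ s) a = b)"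

lemma reaches_refl: "reaches a a"
  unfolding reaches_def by (metis funpow_0)

lemma reaches_trans [trans]:
  assumes "reaches a b" and "reaches b c"
  shows "reaches a c"
  using assms unfolding reaches_def by (metis funpow_add comp_apply)

lemma reaches_step: "reaches (step a) b \<Longrightarrow> reaches a b"
  unfolding reaches_def by (metis funpow_Suc_right comp_apply)

lemma reaches_eval: "reaches (eval_step p xs k) b \<Longrightarrow> reaches (eval_state p xs k) b"
  by (rule reaches_step) (simp add: step_eval_state)

lemma reaches_return:
  "reaches (resume_step v t c k) b \<Longrightarrow> reaches (return_state v (cons (pair t c) k)) b"
  by (rule reaches_step) (simp add: step_return_state)

lemma reaches_Proj:
  "i < length xs \<Longrightarrow>
    reaches (eval_state (pair 2 i) (list_encode xs) k) (return_state (xs ! i) k)"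
proof (induction i arbitrary: xs)
  case 0
  then show ?case
    by (cases xs) (auto simp: eval_step_def intro!: reaches_eval reaches_refl)
next
  case (Suc i)
  then show ?case
    by (cases xs) (auto simp: eval_step_def intro!: reaches_eval)
qed

text \<open>Frame 3 evaluates the arguments from left to right and leaves one frame 4 per value;
  these rebuild the list on the way back. Each argument runs on a different stack, hence the
  quantifier over stacks in the hypothesis.\<close>

lemma reaches_arguments:
  assumes "list_all2 (\<lambda>g y. \<forall>k. reaches (eval_state (code g) xs k) (return_state y k)) gs ys"
  shows "reaches (eval_state (pair 6 (list_encode (map code gs))) xs k)
    (return_state (list_encode ys) k)"
  using assms
proof (induction arbitrary: k rule: list_all2_induct)
  case Nil
  show ?case
    by (rule reaches_eval) (simp add: eval_step_def reaches_refl)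
next
  case (Cons g gs y ys)
  let ?l = "list_encode (map code gs)"
  have "reaches (eval_state (pair 6 (cons (code g) ?l)) xs k)
      (return_state y (cons (pair 3 (pair ?l xs)) k))"
    by (rule reaches_eval) (simp add: eval_step_def Cons)
  also have "reaches \<dots> (return_state (list_encode ys) (cons (pair 4 y) k))"
    by (rule reaches_return) (simp add: resume_step_def Cons)
  also have "reaches \<dots> (return_state (list_encode (y # ys)) k)"
    by (rule reaches_return) (simp add: resume_step_def reaches_refl)
  finally show ?case by simp
qed

text \<open>The stack \<open>k\<close> is arbitrary in the induction because subprograms run on top
  of the frames pushed by their callers.\<close>

lemma computes_reaches:
  "computes p xs v \<Longrightarrow> reaches (eval_state (code p) (list_encode xs) k) (return_state v k)"
proof (induction arbitrary: k rule: computes.induct)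
  case (Zero xs)
  show ?case by (rule reaches_eval) (simp add: eval_step_def reaches_refl)
next
  case (Succ x)
  show ?case by (rule reaches_eval) (simp add: eval_step_def reaches_refl)
next
  case (Proj i xs)
  then show ?case by (simp add: reaches_Proj)
next
  case (Comp xs gs ys f v)
  have args: "list_all2
      (\<lambda>g y. \<forall>k. reaches (eval_state (code g) (list_encode xs) k) (return_state y k)) gs ys"
    using Comp.IH(1) by (rule list_all2_mono) blast
  have "reaches (eval_state (code (Comp f gs)) (list_encode xs) k)
      (return_state (list_encode ys) (cons (pair 0 (code f)) k))"
    by (rule reaches_eval) (simp add: eval_step_def reaches_arguments[OF args])
  also have "reaches \<dots> (return_state v k)"
    by (rule reaches_return) (simp add: resume_step_def Comp.IH)
  finally show ?case .
next
  case (PRec_0 f xs v g)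
  show ?case by (rule reaches_eval) (simp add: eval_step_def PRec_0.IH)
next
  case (PRec_Suc f g n xs u v)
  have "reaches (eval_state (code (PRec f g)) (list_encode (Suc n # xs)) k)
      (return_state u (cons (pair 1 (pair (code g) (list_encode (n # xs)))) k))"
    using PRec_Suc.IH(1) by (intro reaches_eval) (simp add: eval_step_def)
  also have "reaches \<dots> (return_state v k)"
    using PRec_Suc.IH(2) by (intro reaches_return) (simp add: resume_step_def)
  finally show ?case .
next
  case (Mu f z xs)
  let ?try = "\<lambda>i. eval_state (code f) (list_encode (i # xs))
    (cons (pair 2 (pair (code f) (list_encode (i # xs)))) k)"
  \<comment> \<open>Search invariant: candidate \<open>i\<close> comes under test once all smaller
    candidates have given nonzero values.\<close>
  have "reaches (eval_state (code (Mu f)) (list_encode xs) k) (?try i)" if "i \<le> z" for i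
    using that
  proof (induction i)
    case 0
    show ?case by (rule reaches_eval) (simp add: eval_step_def reaches_refl)
  next
    case (Suc i)
    then obtain u where u: "\<And>k. reaches (eval_state (code f) (list_encode (i # xs)) k)
        (return_state (Suc u) k)"
      using Mu.IH(2) by (metis Suc_le_lessD)
    have "reaches (eval_state (code (Mu f)) (list_encode xs) k) (?try i)"
      using Suc by simp
    also have "reaches \<dots>
        (return_state (Suc u) (cons (pair 2 (pair (code f) (list_encode (i # xs)))) k))"
      by (rule u)
    also have "reaches \<dots> (?try (Suc i))"
      by (rule reaches_return) (simp add: resume_step_def reaches_refl)
    finally show ?case .
  qed
  then have "reaches (eval_state (code (Mu f)) (list_encode xs) k) (?try z)"
    by simp
  also have "reaches \<dots> (return_state 0 (cons (pair 2 (pair (code f) (list_encode (z # xs)))) k))"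
    by (rule Mu.IH(1))
  also have "reaches \<dots> (return_state z k)"
    by (rule reaches_return) (simp add: resume_step_def reaches_refl)
  finally show ?case .
qed

section \<open>Uniqueness of the halting time and diagonalization\<close>

lemma final_time_unique:
  assumes "(step ^^ s) a = return_state v 0" and "(step ^^ t) a = return_state w 0"
  shows "s = t"
proof -
  \<comment> \<open>A final state is left for \<open>pair 2 0\<close>, which is absorbing and whose
    tag is not that of a return state, so no second final state follows.\<close>
  have stuck: "(step ^^ m) (pair 2 0) = pair 2 0" for m
    by (induction m) (simp_all add: step_def)
  have final: "step (return_state v 0) = pair 2 0" for v
    by (simp add: step_def return_state_def)
  have "\<not> s < t" if st: "(step ^^ s) a = return_state v 0" "(step ^^ t) a = return_state w 0"
    for s t v w
  proof
    assume "s < t"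
    then obtain m where "t = m + Suc s"
      by (metis add.commute add_Suc_right less_iff_Suc_add)
    then have "(step ^^ t) a = (step ^^ m) (step ((step ^^ s) a))"
      by (simp only: funpow_add funpow.simps comp_apply)
    then have "(step ^^ t) a = pair 2 0"
      by (simp only: st(1) final stuck)
    with st(2) show False
      by (simp add: return_state_def)
  qed
  with assms show ?thesis
    by (meson linorder_neqE_nat)
qed

text \<open>\<open>cons n 0\<close> codes the list \<open>[n]\<close>, and the following 0 is the
  empty stack. The machine runs on every \<open>n\<close>, whether or not \<open>n\<close> is the
  code of a program.\<close>

definition self_returns_0 :: "nat \<Rightarrow> nat \<Rightarrow> bool" where
  "self_returns_0 n s \<longleftrightarrow> (step ^^ s) (eval_state n (cons n 0) 0) = return_state 0 0"

text \<open>Time 0 is thereby free to serve as the base level of the points.\<close>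

lemma not_self_returns_0_at_0: "\<not> self_returns_0 n 0"
  by (simp add: self_returns_0_def eval_state_def return_state_def)

lemma self_returns_0_unique: "self_returns_0 n s \<Longrightarrow> self_returns_0 n t \<Longrightarrow> s = t"
  unfolding self_returns_0_def by (rule final_time_unique)

lemma total_recursive_if_self_returns_0:
  assumes "total_recursive k n" and "total_recursive k s"
    and "total_recursive k f" and "total_recursive k g"
  shows "total_recursive k (\<lambda>xs. if self_returns_0 (n xs) (s xs) then f xs else g xs)"
  unfolding self_returns_0_def eval_state_def return_state_def cons_def
  by (intro total_recursive_intros total_recursive_funpow_step assms)

text \<open>A decider run on its own code would return 0 exactly when it does not.\<close>

lemma self_returns_0_undecidable:
  "\<not> total_recursive 1 (\<lambda>xs. if \<exists>s. self_returns_0 (xs ! 0) s then 1 else 0)"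
proof
  assume "total_recursive 1 (\<lambda>xs. if \<exists>s. self_returns_0 (xs ! 0) s then 1 else 0)"
  then obtain p where p: "\<And>xs. length xs = 1 \<Longrightarrow>
      computes p xs (if \<exists>s. self_returns_0 (xs ! 0) s then 1 else 0)"
    unfolding total_recursive_def by blast
  define n where "n = code p"
  have "computes p [n] (if \<exists>s. self_returns_0 n s then 1 else 0)"
    using p[of "[n]"] by simp
  from computes_reaches[OF this, of 0]
  obtain t where t: "(step ^^ t) (eval_state n (cons n 0) 0) =
      return_state (if \<exists>s. self_returns_0 n s then 1 else 0) 0"
    unfolding reaches_def n_def by auto
  show False
  proof (cases "\<exists>s. self_returns_0 n s")
    case True
    then obtain s where s: "(step ^^ s) (eval_state n (cons n 0) 0) = return_state 0 0"
      unfolding self_returns_0_def by blast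
    \<comment> \<open>The simulated run of the decider ends at time \<open>t\<close> with value 1;
      uniqueness of the final time identifies this state with the one returning 0.\<close>
    then have "s = t"
      using t by (rule final_time_unique)
    with s t True show False
      by (simp add: return_state_def)
  next
    case False
    with t show False
      by (auto simp: self_returns_0_def)
  qed
qed

section \<open>Decidable and semi-decidable relations\<close>

lemma decidable_rel_iff_total_recursive:
  "decidable_rel R \<longleftrightarrow> total_recursive 2 (\<lambda>xs. if (xs ! 0, xs ! 1) \<in> R then 1 else 0)"
proof
  assume "decidable_rel R"
  then obtain p where p: "\<And>x y. computes p [x, y] (if (x, y) \<in> R then 1 else 0)"
    unfolding decidable_rel_def by blast
  have "computes p xs (if (xs ! 0, xs ! 1) \<in> R then 1 else 0)" if "length xs = 2" for xs
  proof -
    have "xs = [xs ! 0, xs ! 1]"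
      using that by (auto simp: numeral_2_eq_2 length_Suc_conv)
    with p[of "xs ! 0" "xs ! 1"] show ?thesis by metis
  qed
  then show "total_recursive 2 (\<lambda>xs. if (xs ! 0, xs ! 1) \<in> R then 1 else 0)"
    unfolding total_recursive_def by blast
next
  assume "total_recursive 2 (\<lambda>xs. if (xs ! 0, xs ! 1) \<in> R then 1 else 0)"
  then obtain p where p: "\<And>xs. length xs = 2 \<Longrightarrow>
      computes p xs (if (xs ! 0, xs ! 1) \<in> R then 1 else 0)"
    unfolding total_recursive_def by blast
  have "computes p [x, y] (if (x, y) \<in> R then 1 else 0)" for x y
    using p[of "[x, y]"] by simp
  then show "decidable_rel R"
    unfolding decidable_rel_def by blast
qed

lemma total_recursive_if_decidable:
  assumes "decidable_rel R" and "total_recursive k a" and "total_recursive k b"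
    and "total_recursive k f" and "total_recursive k g"
  shows "total_recursive k (\<lambda>xs. if (a xs, b xs) \<in> R then f xs else g xs)"
proof (rule total_recursive_cong)
  have "total_recursive k (\<lambda>xs. if (a xs, b xs) \<in> R then 1 else 0)"
    using total_recursive_compose2[OF _ assms(2,3), of "\<lambda>x y. if (x, y) \<in> R then 1 else 0"]
      assms(1) by (simp add: decidable_rel_iff_total_recursive)
  then show "total_recursive k
      (\<lambda>xs. if (if (a xs, b xs) \<in> R then 1 else 0) = (0 :: nat) then g xs else f xs)"
    by (intro total_recursive_if_eq total_recursive_const assms)
qed simp

text \<open>Meant for maps to class representatives: if these are recursive, equivalence becomes an
  equality test.\<close>

lemma decidable_kernel:
  assumes "total_recursive 1 (\<lambda>xs. f (xs ! 0))"
  shows "decidable_rel {(x, y). f x = f y}"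
  unfolding decidable_rel_iff_total_recursive mem_Collect_eq prod.case
  by (intro total_recursive_if_eq total_recursive_compose1[OF assms] total_recursive_nth
      total_recursive_const) simp_all

text \<open>Unbounded search for a zero of \<open>h\<close>; as \<open>h\<close> is total,
  \<open>Mu\<close> cannot get stuck before reaching one. The searched variable comes first because
  \<open>Mu\<close> prepends its candidate.\<close>

lemma semidecidable_relI:
  assumes h: "total_recursive 3 (\<lambda>xs. h (xs ! 0) (xs ! 1) (xs ! 2))"
    and R: "\<And>x y. (x, y) \<in> R \<longleftrightarrow> (\<exists>z. h z x y = 0)"
  shows "semidecidable_rel R"
proof -
  obtain p where p: "\<And>xs. length xs = 3 \<Longrightarrow> computes p xs (h (xs ! 0) (xs ! 1) (xs ! 2))"
    using h unfolding total_recursive_def by blast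
  have p: "computes p [z, x, y] (h z x y)" for z x y
    using p[of "[z, x, y]"] by simp
  have "(x, y) \<in> R \<longleftrightarrow> (\<exists>v. computes (Mu p) [x, y] v)" for x y
  proof
    assume "(x, y) \<in> R"
    then have ex: "\<exists>z. h z x y = 0"
      using R by blast
    let ?z = "LEAST z. h z x y = 0"
    have "computes p [?z, x, y] 0"
      using p[of ?z x y] LeastI_ex[OF ex] by simp
    moreover have "\<forall>i<?z. \<exists>u. computes p [i, x, y] (Suc u)"
      using p not_less_Least by (metis (mono_tags, lifting) not0_implies_Suc)
    ultimately have "computes (Mu p) [x, y] ?z"
      by (rule computes.Mu)
    then show "\<exists>v. computes (Mu p) [x, y] v" by blast
  next
    assume "\<exists>v. computes (Mu p) [x, y] v"
    then obtain z where "computes p [z, x, y] 0"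
      by (auto elim: computes.cases)
    then show "(x, y) \<in> R"
      using R p computes_deterministic by metis
  qed
  then show ?thesis
    unfolding semidecidable_rel_def by blast
qed

text \<open>The search runs over both intermediate points at once, coded as one number
  \<open>z\<close>.\<close>

lemma semidecidable_FGF:
  assumes F: "decidable_rel F" and G: "decidable_rel G"
  shows "semidecidable_rel (F O G O F)"
proof (rule semidecidable_relI)
  let ?h = "\<lambda>z x y. if (x, left z) \<in> F then
    (if (left z, right z) \<in> G then (if (right z, y) \<in> F then 0 else 1) else 1) else (1 :: nat)"
  show "total_recursive 3 (\<lambda>xs. ?h (xs ! 0) (xs ! 1) (xs ! 2))"
    by (intro total_recursive_if_decidable F G total_recursive_intros total_recursive_nth) simp_all
  show "(x, y) \<in> F O G O F \<longleftrightarrow> (\<exists>z. ?h z x y = 0)" for x y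
  proof
    assume "(x, y) \<in> F O G O F"
    then obtain u w where "(x, u) \<in> F" "(u, w) \<in> G" "(w, y) \<in> F" by blast
    then have "?h (pair u w) x y = 0" by simp
    then show "\<exists>z. ?h z x y = 0" ..
  qed (auto split: if_splits)
qed

section \<open>The two equivalence relations\<close>

lemma equiv_kernel: "equiv UNIV {(x, y). f x = f y}"
  by (auto simp: equiv_def refl_on_def sym_def trans_def)

text \<open>When two \<open>FGF\<close> paths are concatenated, the adjacent \<open>F\<close> links
  merge and an inner \<open>GFG\<close> appears, which the hypothesis absorbs. So
  \<open>F O G O F\<close> is transitive, and it contains \<open>F \<union> G\<close> by
  reflexivity.\<close>

lemma equiv_join_eq_FGF:
  assumes F: "equiv UNIV F" and G: "equiv UNIV G" and GFG: "G O F O G \<subseteq> F O G O F"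
  shows "equiv_join F G = F O G O F"
proof
  have refl: "(x, x) \<in> F" "(x, x) \<in> G" for x
    using F G by (auto simp: equiv_def refl_on_def)
  have F_trans: "F O F \<subseteq> F"
    using F by (auto simp: equiv_def trans_def)
  show "F O G O F \<subseteq> equiv_join F G"
    unfolding equiv_join_def by (blast intro: trancl_trans)
  have "trans (F O G O F)"
  proof (rule transI)
    fix x y z
    assume "(x, y) \<in> F O G O F" and "(y, z) \<in> F O G O F"
    then obtain a b c d where *: "(x, a) \<in> F" "(a, b) \<in> G" "(b, y) \<in> F"
      "(y, c) \<in> F" "(c, d) \<in> G" "(d, z) \<in> F" by blast
    then have "(b, c) \<in> F" using F_trans by blast
    with * have "(a, d) \<in> F O G O F" using GFG by blast
    with * show "(x, z) \<in> F O G O F" using F_trans by blast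
  qed
  moreover have "F \<union> G \<subseteq> F O G O F"
  proof
    fix e
    assume "e \<in> F \<union> G"
    then show "e \<in> F O G O F"
      using refl by (cases e) blast
  qed
  ultimately show "equiv_join F G \<subseteq> F O G O F"
    unfolding equiv_join_def by (metis trancl_id trancl_mono_subset)
qed

lemma equiv_equiv_join:
  assumes "equiv UNIV F" and "equiv UNIV G"
  shows "equiv UNIV (equiv_join F G)"
proof (rule equivI)
  have "sym (F \<union> G)"
    using assms by (auto simp: equiv_def intro: sym_Un)
  then show "sym (equiv_join F G)"
    unfolding equiv_join_def by (rule sym_trancl)
  show "refl (equiv_join F G)"
    using assms by (auto simp: equiv_join_def equiv_def refl_on_def)
qed (simp_all add: equiv_join_def)

text \<open>Pairing is onto, so every number is a point, also with \<open>i > 1\<close>;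
  \<open>G_rel\<close> leaves such points alone, while \<open>F_rel\<close> treats all copies
  alike.\<close>

definition point :: "nat \<Rightarrow> nat \<Rightarrow> nat \<Rightarrow> nat" where
  "point i n s = pair i (pair n s)"

lemma point_eq_iff [simp]: "point i n s = point j m t \<longleftrightarrow> i = j \<and> n = m \<and> s = t"
  by (simp add: point_def)

lemma point_cases: obtains i n s where "x = point i n s"
  unfolding point_def by (metis pair_left_right)

definition f_rep :: "nat \<Rightarrow> nat" where
  "f_rep x = (if self_returns_0 (left (right x)) (right (right x))
    then point (left x) (left (right x)) 0 else x)"

text \<open>The condition is split into nested equality tests, the form covered by
  \<open>total_recursive_if_eq\<close>.\<close>

definition g_rep :: "nat \<Rightarrow> nat" where
  "g_rep x = (if left x = 1 then if right (right x) = 0 then x else pair 0 (right x) else x)"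

definition F_rel :: "(nat \<times> nat) set" where
  "F_rel = {(x, y). f_rep x = f_rep y}"

definition G_rel :: "(nat \<times> nat) set" where
  "G_rel = {(x, y). g_rep x = g_rep y}"

lemma equiv_F_rel: "equiv UNIV F_rel" and equiv_G_rel: "equiv UNIV G_rel"
  unfolding F_rel_def G_rel_def by (rule equiv_kernel)+

lemma decidable_F_rel: "decidable_rel F_rel"
  unfolding F_rel_def f_rep_def[abs_def] point_def
  by (intro decidable_kernel total_recursive_if_self_returns_0 total_recursive_intros
      total_recursive_nth) simp_all

lemma decidable_G_rel: "decidable_rel G_rel"
  unfolding G_rel_def g_rep_def[abs_def]
  by (intro decidable_kernel total_recursive_intros total_recursive_nth) simp_all

text \<open>Two distinct positive levels never meet, as the halting time is unique; level 0
  represents itself, as that time is never 0.\<close>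

lemma F_rel_point_iff:
  "(point i n s, point j m t) \<in> F_rel \<longleftrightarrow> i = j \<and> n = m \<and>
    (s = t \<or> s = 0 \<and> self_returns_0 n t \<or> t = 0 \<and> self_returns_0 n s)"
  using not_self_returns_0_at_0 self_returns_0_unique
  by (auto simp: F_rel_def f_rep_def point_def)

lemma G_rel_point_iff:
  "(point i n s, point j m t) \<in> G_rel \<longleftrightarrow> n = m \<and> s = t \<and>
    (i = j \<or> s > 0 \<and> i \<le> 1 \<and> j \<le> 1)"
  by (auto simp: G_rel_def g_rep_def point_def le_Suc_eq split: if_splits)

text \<open>Of two distinct points linked by \<open>F_rel\<close> one is on level 0, where
  \<open>G_rel\<close> is the identity. So a \<open>GFG\<close> path has a trivial \<open>G\<close>
  link, or a trivial \<open>F\<close> link, in which case its \<open>G\<close> links merge.\<close>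

lemma GFG_subset: "G_rel O F_rel O G_rel \<subseteq> F_rel O G_rel O F_rel"
proof (clarify)
  fix x y z w
  assume xy: "(x, y) \<in> G_rel" and yz: "(y, z) \<in> F_rel" and zw: "(z, w) \<in> G_rel"
  obtain i n s where x: "x = point i n s" by (rule point_cases)
  obtain j m t where w: "w = point j m t" by (rule point_cases)
  have refl: "(u, u) \<in> F_rel" for u
    by (simp add: F_rel_def)
  obtain i' n' s' where y: "y = point i' n' s'" by (rule point_cases)
  obtain j' m' t' where z: "z = point j' m' t'" by (rule point_cases)
  have "y = z \<or> x = y \<or> z = w"
    using xy yz zw unfolding x y z w by (auto simp: F_rel_point_iff G_rel_point_iff)
  moreover have "(x, w) \<in> G_rel" if "y = z"
    using xy zw that by (simp add: G_rel_def)
  ultimately show "(x, w) \<in> F_rel O G_rel O F_rel"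
    using xy yz zw refl by blast
qed

section \<open>Finiteness of the classes\<close>

lemma finite_F_rel_class: "finite (F_rel `` {x})"
proof -
  obtain i n s where x: "x = point i n s" by (rule point_cases)
  have "F_rel `` {x} \<subseteq> {x, point i n 0} \<union> point i n ` {t. self_returns_0 n t}"
  proof
    fix y
    assume y: "y \<in> F_rel `` {x}"
    obtain j m t where "y = point j m t" by (rule point_cases)
    with y show "y \<in> {x, point i n 0} \<union> point i n ` {t. self_returns_0 n t}"
      unfolding x by (auto simp: F_rel_point_iff)
  qed
  moreover have "finite {t. self_returns_0 n t}"
  proof (cases "\<exists>t. self_returns_0 n t")
    case True
    then obtain t where "self_returns_0 n t" ..
    then have "{t. self_returns_0 n t} \<subseteq> {t}"
      using self_returns_0_unique by blast
    then show ?thesis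
      by (rule finite_subset) simp
  qed simp
  ultimately show ?thesis
    by (meson finite.emptyI finite.insertI finite_UnI finite_imageI finite_subset)
qed

lemma finite_G_rel_class: "finite (G_rel `` {x})"
proof -
  obtain i n s where x: "x = point i n s" by (rule point_cases)
  \<comment> \<open>Only the copies 0 and 1 can be merged, and \<open>n\<close> and the level are
    kept; \<open>insert i\<close> covers the copies beyond 1.\<close>
  have "G_rel `` {x} \<subseteq> (\<lambda>j. point j n s) ` insert i {..1}"
  proof
    fix y
    assume y: "y \<in> G_rel `` {x}"
    obtain j m t where "y = point j m t" by (rule point_cases)
    with y show "y \<in> (\<lambda>j. point j n s) ` insert i {..1}"
      unfolding x by (auto simp: G_rel_point_iff)
  qed
  then show ?thesis
    by (rule finite_subset) simp
qed

text \<open>A finite union of finite sets is finite; two applications carry this over to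
  \<open>F O G O F\<close>.\<close>

lemma finite_relcomp_classes:
  assumes "\<And>x. finite (R `` {x})" and "\<And>x. finite (S `` {x})"
  shows "finite ((R O S) `` {x})"
proof -
  have "(R O S) `` {x} = (\<Union>y \<in> R `` {x}. S `` {y})" by blast
  then show ?thesis
    using assms by simp
qed

section \<open>Reduction of the halting problem to the join\<close>

lemma point_FGF_iff:
  "(point 0 n 0, point 1 n 0) \<in> F_rel O G_rel O F_rel \<longleftrightarrow> (\<exists>s. self_returns_0 n s)"
proof
  assume "(point 0 n 0, point 1 n 0) \<in> F_rel O G_rel O F_rel"
  then obtain u w where *: "(point 0 n 0, u) \<in> F_rel" "(u, w) \<in> G_rel" "(w, point 1 n 0) \<in> F_rel"
    by blast
  obtain i m s where u: "u = point i m s" by (rule point_cases)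
  obtain j m' t where w: "w = point j m' t" by (rule point_cases)
  \<comment> \<open>If \<open>u\<close> were on level 0, the \<open>G\<close> link could not change
    the copy from 0 to 1; hence \<open>u\<close> lies at the halting level.\<close>
  from * show "\<exists>s. self_returns_0 n s"
    unfolding u w by (auto simp: F_rel_point_iff G_rel_point_iff)
next
  assume "\<exists>s. self_returns_0 n s"
  then obtain s where s: "self_returns_0 n s" ..
  then have "s > 0"
    using not_self_returns_0_at_0 by (metis gr0I)
  with s have "(point 0 n 0, point 0 n s) \<in> F_rel" "(point 0 n s, point 1 n s) \<in> G_rel"
    "(point 1 n s, point 1 n 0) \<in> F_rel"
    by (simp_all add: F_rel_point_iff G_rel_point_iff)
  then show "(point 0 n 0, point 1 n 0) \<in> F_rel O G_rel O F_rel"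
    by blast
qed

text \<open>Sending \<open>n\<close> to its base points in the copies 0 and 1 is a recursive
  reduction of an undecidable set.\<close>

lemma undecidable_FGF: "\<not> decidable_rel (F_rel O G_rel O F_rel)"
proof
  assume "decidable_rel (F_rel O G_rel O F_rel)"
  then have "total_recursive 1 (\<lambda>xs.
      if (point 0 (xs ! 0) 0, point 1 (xs ! 0) 0) \<in> F_rel O G_rel O F_rel then 1 else 0)"
    unfolding point_def
    by (intro total_recursive_if_decidable total_recursive_intros total_recursive_nth) simp_all
  then show False
    using self_returns_0_undecidable unfolding point_FGF_iff by contradiction
qed

theorem proposition5:
  "\<exists>F G :: (nat \<times> nat) set.
     equiv UNIV F \<and> decidable_rel F \<and>
     equiv UNIV G \<and> decidable_rel G \<and>
     semidecidable_rel (equiv_join F G) \<and>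
     FC_equiv (equiv_join F G) \<and>
     \<not> decidable_rel (equiv_join F G) \<and>
     equiv_join F G = F O G O F"
proof (intro exI conjI)
  show join: "equiv_join F_rel G_rel = F_rel O G_rel O F_rel"
    by (rule equiv_join_eq_FGF[OF equiv_F_rel equiv_G_rel GFG_subset])
  show "semidecidable_rel (equiv_join F_rel G_rel)"
    unfolding join by (rule semidecidable_FGF[OF decidable_F_rel decidable_G_rel])
  show "\<not> decidable_rel (equiv_join F_rel G_rel)"
    unfolding join by (rule undecidable_FGF)
  have "finite (equiv_join F_rel G_rel `` {x})" for x
    unfolding join by (intro finite_relcomp_classes finite_F_rel_class finite_G_rel_class)
  then show "FC_equiv (equiv_join F_rel G_rel)"
    unfolding FC_equiv_def
    using equiv_equiv_join[OF equiv_F_rel equiv_G_rel] by (auto elim!: quotientE)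
qed (rule equiv_F_rel equiv_G_rel decidable_F_rel decidable_G_rel)+

end
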